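(* Let $G$ be a finite simple $r$-regular graph with $r \geq 2$, and let $p, q$ be non-negative integers with $p \leq q < 3$. Then \[ \alpha_p(G) \leq \alpha_q(L(G)). \]
   Context: For a graph $G$ and a non-negative integer $p$, a set $S \subseteq V(G)$ is $p$-independent if the subgraph induced by $S$ has maximum degree at most $p$; $\alpha_p(G)$ denotes the maximum cardinality of a $p$-independent set of $G$. $L(G)$ is the line graph of $G$. *)

theory Defs
  imports "Graph_Theory.Graph_Theory"
begin

text \<open>
  A finite simple graph is a \<^locale>\<open>graph\<close>: a finite, loop-free, symmetric digraph without
  parallel arcs. An undirected edge is thus a pair of opposite arcs, and the degree of a vertex
  is its \<^const>\<open>out_degree\<close>. The null graph is allowed.
\<close>

definition regular :: "nat \<Rightarrow> ('a, 'b) pre_digraph \<Rightarrow> bool" where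
  "regular r G \<longleftrightarrow> (\<forall>v \<in> verts G. out_degree G v = r)"

definition p_independent :: "nat \<Rightarrow> ('a, 'b) pre_digraph \<Rightarrow> 'a set \<Rightarrow> bool" where
  "p_independent p G S \<longleftrightarrow>
     S \<subseteq> verts G \<and> (\<forall>v \<in> S. out_degree (induce_subgraph G S) v \<le> p)"

definition p_independence_number :: "nat \<Rightarrow> ('a, 'b) pre_digraph \<Rightarrow> nat" where
  "p_independence_number p G = Max (card ` {S. p_independent p G S})"

text \<open>The two opposite arcs of an edge give the same element here.\<close>

definition undirected_edges :: "('a, 'b) pre_digraph \<Rightarrow> 'a set set" where
  "undirected_edges G = {{u, v} | u v. (u, v) \<in> arcs_ends G}"

definition line_graph :: "('a, 'b) pre_digraph \<Rightarrow> ('a set, 'a set \<times> 'a set) pre_digraph" where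
  "line_graph G = with_proj
     \<lparr> pverts = undirected_edges G,
       parcs = {(e, f). e \<in> undirected_edges G \<and> f \<in> undirected_edges G
                        \<and> e \<noteq> f \<and> e \<inter> f \<noteq> {}} \<rparr>"

lemma finite_undirected_edges:
  assumes "graph G"
  shows "finite (undirected_edges G)"
proof -
  interpret graph G by fact
  have "undirected_edges G = (\<lambda>(u, v). {u, v}) ` arcs_ends G"
    by (auto simp: undirected_edges_def)
  then show ?thesis
    by (simp add: arcs_ends_def)
qed

lemma graph_line_graph:
  assumes "graph G"
  shows "graph (line_graph G)"
proof -
  have fin: "finite (undirected_edges G)"
    using assms by (rule finite_undirected_edges)
  have "finite {(e, f). e \<in> undirected_edges G \<and> f \<in> undirected_edges G
                        \<and> e \<noteq> f \<and> e \<inter> f \<noteq> {}}"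
    by (rule finite_subset[OF _ finite_cartesian_product[OF fin fin]]) auto
  then show ?thesis
    using fin unfolding line_graph_def
    by unfold_locales (auto simp: arc_to_ends_def symmetric_def intro!: symI)
qed

text \<open>The maximum in \<^const>\<open>p_independence_number\<close> is taken over a finite nonempty set.\<close>

lemma finite_p_independent:
  assumes "graph G"
  shows "finite {S. p_independent p G S}"
proof -
  interpret graph G by fact
  show ?thesis
    by (rule finite_subset[of _ "Pow (verts G)"]) (auto simp: p_independent_def)
qed

lemma p_independent_empty: "p_independent p G {}"
  by (simp add: p_independent_def)

end

theory Submission
  imports Defs
begin

text \<open>
  Since \<open>p \<le> q \<le> 2\<close>, a \<open>p\<close>-independent set \<open>S\<close> induces paths and cycles. Hall's theorem assigns to
  the vertices of \<open>S\<close> distinct incident edges in such a way that a vertex with two neighbours in \<open>S\<close>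
  receives an edge inside \<open>S\<close>, and edges leaving \<open>S\<close> have distinct outer ends. Hall's condition
  follows from a fractional assignment: weight \<open>1/2\<close> on each edge inside \<open>S\<close>, counted at both ends,
  and \<open>1/r\<close> on each outer vertex, counted at its at most \<open>r\<close> neighbours in \<open>S\<close>; a vertex with one
  neighbour in \<open>S\<close> collects \<open>1/2 + (r - 1)/r \<ge> 1\<close>. The chosen edges form a \<open>q\<close>-independent set
  of the line graph.
\<close>

section \<open>Hall's theorem, plain and weighted\<close>

text \<open>The Halmos-Vaughan induction. If some nonempty proper subfamily \<open>J\<close> is
  tight, it is solved by itself and the rest is solved avoiding everything \<open>J\<close> can use.
  Otherwise each nonempty proper subfamily has an element to spare, so one index may choose
  freely.\<close>

lemma hall_marriage:
  fixes A :: "'a \<Rightarrow> 'b set"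
  assumes "finite I" and "\<And>i. i \<in> I \<Longrightarrow> finite (A i)"
    and "\<And>J. J \<subseteq> I \<Longrightarrow> card J \<le> card (\<Union> (A ` J))"
  shows "\<exists>f. inj_on f I \<and> (\<forall>i\<in>I. f i \<in> A i)"
  using assms
proof (induction I arbitrary: A rule: finite_psubset_induct)
  case (psubset I)
  note fin = psubset.prems(1) and hall = psubset.prems(2)
  show ?case
  proof (cases "\<exists>J. J \<noteq> {} \<and> J \<subset> I \<and> card (\<Union> (A ` J)) = card J")
    case True
    then obtain J where J: "J \<noteq> {}" "J \<subset> I" "card (\<Union> (A ` J)) = card J" by blast
    have finJ: "finite J" using J(2) psubset.hyps by (auto intro: finite_subset)
    have finU: "finite (\<Union> (A ` J))" using J(2) finJ fin by auto
    have "\<exists>f. inj_on f J \<and> (\<forall>i\<in>J. f i \<in> A i)"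
      using J(2) fin hall by (intro psubset.IH) auto
    then obtain f where f: "inj_on f J" "\<forall>i\<in>J. f i \<in> A i" by blast
    have "\<exists>g. inj_on g (I - J) \<and> (\<forall>i\<in>I - J. g i \<in> A i - \<Union> (A ` J))"
    proof (rule psubset.IH)
      show "I - J \<subset> I" using J by blast
      show "finite (A i - \<Union> (A ` J))" if "i \<in> I - J" for i using that fin by auto
      fix K assume K: "K \<subseteq> I - J"
      have finK: "finite K" using K psubset.hyps by (auto intro: finite_subset)
      have finUK: "finite (\<Union>i\<in>K. A i - \<Union> (A ` J))" using K finK fin by auto
      \<comment> \<open>As \<open>J\<close> is tight, cancelling its share from Hall's condition for
        \<open>K \<union> J\<close> leaves the condition for \<open>K\<close> in the reduced
        sets.\<close>
      have "card K + card J = card (K \<union> J)"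
        using K finK finJ by (subst card_Un_disjoint) auto
      also have "\<dots> \<le> card (\<Union> (A ` (K \<union> J)))" using K J(2) by (intro hall) auto
      also have "\<Union> (A ` (K \<union> J)) = (\<Union>i\<in>K. A i - \<Union> (A ` J)) \<union> \<Union> (A ` J)" by auto
      also have "card \<dots> = card (\<Union>i\<in>K. A i - \<Union> (A ` J)) + card (\<Union> (A ` J))"
        using finUK finU by (subst card_Un_disjoint) auto
      finally show "card K \<le> card (\<Union>i\<in>K. A i - \<Union> (A ` J))" using J(3) by simp
    qed
    then obtain g where g: "inj_on g (I - J)" "\<forall>i\<in>I - J. g i \<in> A i - \<Union> (A ` J)" by blast
    let ?h = "\<lambda>i. if i \<in> J then f i else g i"
    have "inj_on ?h I"
    proof (rule inj_onI)
      fix x y assume xy: "x \<in> I" "y \<in> I" "?h x = ?h y"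
      show "x = y"
      proof (cases "x \<in> J"; cases "y \<in> J")
        assume "x \<in> J" "y \<in> J"
        then show ?thesis using xy f(1) by (auto dest: inj_onD)
      next
        assume "x \<notin> J" "y \<notin> J"
        then show ?thesis using xy g(1) by (auto dest: inj_onD)
      next
        assume "x \<in> J" "y \<notin> J"
        then have "f x = g y" using xy by simp
        moreover have "f x \<in> A x" using f(2) \<open>x \<in> J\<close> by blast
        moreover have "g y \<notin> \<Union> (A ` J)" using g(2) xy \<open>y \<notin> J\<close> by blast
        ultimately show ?thesis using \<open>x \<in> J\<close> by (metis UN_I)
      next
        assume "x \<notin> J" "y \<in> J"
        then have "f y = g x" using xy by simp
        moreover have "f y \<in> A y" using f(2) \<open>y \<in> J\<close> by blast
        moreover have "g x \<notin> \<Union> (A ` J)" using g(2) xy \<open>x \<notin> J\<close> by blast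
        ultimately show ?thesis using \<open>y \<in> J\<close> by (metis UN_I)
      qed
    qed
    moreover have "\<forall>i\<in>I. ?h i \<in> A i" using f(2) g(2) by auto
    ultimately show ?thesis by blast
  next
    case False
    show ?thesis
    proof (cases "I = {}")
      case True
      then show ?thesis by simp
    next
      case nonempty: False
      then obtain i where i: "i \<in> I" by blast
      have "card {i} \<le> card (\<Union> (A ` {i}))" using i by (intro hall) auto
      then have "A i \<noteq> {}" by auto
      then obtain a where a: "a \<in> A i" by blast
      have "\<exists>g. inj_on g (I - {i}) \<and> (\<forall>j\<in>I - {i}. g j \<in> A j - {a})"
      proof (rule psubset.IH)
        show "I - {i} \<subset> I" using i by blast
        show "finite (A j - {a})" if "j \<in> I - {i}" for j using that fin by auto
        fix K assume K: "K \<subseteq> I - {i}"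
        show "card K \<le> card (\<Union>j\<in>K. A j - {a})"
        proof (cases "K = {}")
          case True
          then show ?thesis by simp
        next
          case nK: False
          \<comment> \<open>Since \<open>K\<close> misses \<open>i\<close>, it is proper and hence
            not tight; its surplus pays for the loss of \<open>a\<close>.\<close>
          have "K \<subset> I" using K i by blast
          then have "card (\<Union> (A ` K)) \<noteq> card K" using False nK by blast
          moreover have "card K \<le> card (\<Union> (A ` K))" using \<open>K \<subset> I\<close> by (intro hall) blast
          ultimately have "card K < card (\<Union> (A ` K))" by linarith
          then have "card K \<le> card (\<Union> (A ` K)) - 1" by linarith
          also have "\<dots> \<le> card (\<Union> (A ` K) - {a})" by (simp add: card_Diff_singleton_if)
          also have "\<Union> (A ` K) - {a} = (\<Union>j\<in>K. A j - {a})" by auto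
          finally show ?thesis .
        qed
      qed
      then obtain g where g: "inj_on g (I - {i})" "\<forall>j\<in>I - {i}. g j \<in> A j - {a}" by blast
      have "inj_on (g(i := a)) I"
        using g by (auto simp: inj_on_def)
      moreover have "\<forall>j\<in>I. (g(i := a)) j \<in> A j" using g(2) a by auto
      ultimately show ?thesis by blast
    qed
  qed
qed

text \<open>Double counting: \<open>b\<close> gives \<open>w b\<close> to each index whose set
  contains it, at most 1 in total, while each index collects at least 1. So no subfamily can
  outnumber its union.\<close>

lemma hall_marriage_weighted:
  fixes A :: "'a \<Rightarrow> 'b set" and w :: "'b \<Rightarrow> real"
  assumes "finite I" and fin: "\<And>i. i \<in> I \<Longrightarrow> finite (A i)"
    and nonneg: "\<And>b. 0 \<le> w b"
    and lower: "\<And>i. i \<in> I \<Longrightarrow> 1 \<le> (\<Sum>b\<in>A i. w b)"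
    and upper: "\<And>b. real (card {i\<in>I. b \<in> A i}) * w b \<le> 1"
  shows "\<exists>f. inj_on f I \<and> (\<forall>i\<in>I. f i \<in> A i)"
proof (rule hall_marriage[OF assms(1) fin])
  fix J assume J: "J \<subseteq> I"
  let ?U = "\<Union> (A ` J)"
  have finJ: "finite J" using J assms(1) by (rule finite_subset)
  have finU: "finite ?U" using J finJ fin by auto
  have "real (card J) = (\<Sum>i\<in>J. 1)" by simp
  also have "\<dots> \<le> (\<Sum>i\<in>J. \<Sum>b\<in>A i. w b)"
    using J lower by (intro sum_mono) auto
  also have "\<dots> = (\<Sum>i\<in>J. \<Sum>b\<in>{b\<in>?U. b \<in> A i}. w b)"
    by (intro sum.cong refl) auto
  also have "\<dots> = (\<Sum>b\<in>?U. \<Sum>i\<in>{i\<in>J. b \<in> A i}. w b)"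
    using finJ finU by (rule sum.swap_restrict)
  also have "\<dots> \<le> (\<Sum>b\<in>?U. 1)"
  proof (rule sum_mono)
    fix b
    have "card {i\<in>J. b \<in> A i} \<le> card {i\<in>I. b \<in> A i}"
      using J assms(1) by (intro card_mono) auto
    then have "real (card {i\<in>J. b \<in> A i}) * w b \<le> real (card {i\<in>I. b \<in> A i}) * w b"
      using nonneg by (intro mult_right_mono) auto
    then show "(\<Sum>i\<in>{i\<in>J. b \<in> A i}. w b) \<le> 1" using upper[of b] by simp
  qed
  finally show "card J \<le> card ?U" by simp
qed

section \<open>Assigning an incident edge to each vertex of the independent set\<close>

text \<open>\<open>N\<close> plays the neighbourhood map, and \<open>h x\<close> is the far end of
  the edge given to \<open>x\<close>. The last two conclusions go beyond distinctness of the edges;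
  they control how the edges meet. The bound \<open>le\<close> also covers vertices outside
  \<open>S\<close>, because it limits how many vertices compete for an outer end.\<close>

lemma exists_partner_assignment:
  fixes N :: "'a \<Rightarrow> 'a set"
  assumes "finite S"
    and sym: "\<And>u v. v \<in> N u \<Longrightarrow> u \<in> N v" and irrefl: "\<And>v. v \<notin> N v"
    and fin: "\<And>v. finite (N v)" and le: "\<And>v. card (N v) \<le> r"
    and eq: "\<And>v. v \<in> S \<Longrightarrow> card (N v) = r" and r: "2 \<le> r"
    and deg: "\<And>v. v \<in> S \<Longrightarrow> card (N v \<inter> S) \<le> 2"
  obtains h where "\<And>x. x \<in> S \<Longrightarrow> h x \<in> N x"
    and "inj_on (\<lambda>x. {x, h x}) S"
    and "\<And>x. x \<in> S \<Longrightarrow> h x \<notin> S \<Longrightarrow> card (N x \<inter> S) < 2"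
    and "\<And>x y. x \<in> S \<Longrightarrow> y \<in> S \<Longrightarrow> h x \<notin> S \<Longrightarrow> h x = h y \<Longrightarrow> x = y"
proof -
  \<comment> \<open>An edge inside \<open>S\<close> is represented by the pair of its ends,
      and an edge leaving \<open>S\<close> only by the singleton of its outer end.\<close>
  define E where "E x = (\<lambda>y. {x, y}) ` (N x \<inter> S)" for x
  define T where "T x = (if card (N x \<inter> S) < 2 then (\<lambda>t. {t}) ` (N x - S) else {})" for x
  \<comment> \<open>Cardinality tells inner edges from outer ends: irreflexivity makes each
    \<open>{x, y}\<close> in \<open>E x\<close> a genuine pair.\<close>
  define w where "w b = (if card b = 2 then 1 / 2 else 1 / real r)" for b :: "'a set"
  have "\<exists>f. inj_on f S \<and> (\<forall>x\<in>S. f x \<in> E x \<union> T x)"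
  proof (rule hall_marriage_weighted[where w = w, OF assms(1)])
    show "finite (E x \<union> T x)" for x using fin by (auto simp: E_def T_def)
    show "0 \<le> w b" for b by (simp add: w_def)
    show "1 \<le> (\<Sum>b\<in>E x \<union> T x. w b)" if x: "x \<in> S" for x
    proof -
      let ?d = "card (N x \<inter> S)"
      have cE: "card b = 2" if "b \<in> E x" for b
      proof -
        from that obtain y where "b = {x, y}" "y \<in> N x" by (auto simp: E_def)
        then show ?thesis using irrefl[of x] by (auto simp: card_insert_if)
      qed
      have cT: "card b = 1" if "b \<in> T x" for b
        using that by (auto simp: T_def split: if_splits)
      have "(\<Sum>b\<in>E x \<union> T x. w b) = (\<Sum>b\<in>E x. w b) + (\<Sum>b\<in>T x. w b)"
      proof (rule sum.union_disjoint)
        show "finite (E x)" "finite (T x)" using fin by (simp_all add: E_def T_def)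
        show "E x \<inter> T x = {}" using cE cT by fastforce
      qed
      also have "(\<Sum>b\<in>E x. w b) = real (card (E x)) * (1 / 2)"
        using cE by (simp add: w_def)
      also have "(\<Sum>b\<in>T x. w b) = real (card (T x)) * (1 / real r)"
        using cT by (simp add: w_def)
      also have "card (E x) = ?d"
        unfolding E_def by (intro card_image) (auto simp: inj_on_def doubleton_eq_iff)
      finally have sum: "(\<Sum>b\<in>E x \<union> T x. w b) = real ?d * (1/2) + real (card (T x)) * (1 / real r)" .
      have split: "card (N x - S) = r - ?d"
        using card_Diff_subset_Int[of "N x" S] fin eq[OF x] by simp
      have T: "card (T x) = (if ?d < 2 then r - ?d else 0)"
        by (auto simp: T_def card_image split)
      consider "?d = 0" | "?d = 1" | "?d = 2" using deg[OF x] by linarith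
      then show ?thesis
      proof cases
        case 1
        then show ?thesis using sum T r by simp
      next
        case 2
        then have "(\<Sum>b\<in>E x \<union> T x. w b) = 1 / 2 + (real r - 1) / real r"
          using sum T r by (simp add: of_nat_diff)
        \<comment> \<open>This amounts to \<open>1 / r \<le> 1 / 2\<close>, that is, to
          \<open>2 \<le> r\<close>.\<close>
        also have "\<dots> \<ge> 1" using r by (simp add: field_simps)
        finally show ?thesis .
      next
        case 3
        then show ?thesis using sum T by simp
      qed
    qed
    show "real (card {x\<in>S. b \<in> E x \<union> T x}) * w b \<le> 1" for b
    proof (cases "card b = 2")
      case True
      have "{x\<in>S. b \<in> E x \<union> T x} \<subseteq> b"
        using True by (auto simp: E_def T_def split: if_splits)
      moreover have "finite b" using True card.infinite by fastforce
      ultimately have "card {x\<in>S. b \<in> E x \<union> T x} \<le> 2"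
        using card_mono True by metis
      then show ?thesis using True by (simp add: w_def)
    next
      case False
      have "card {x\<in>S. b \<in> E x \<union> T x} \<le> r"
      proof (cases "\<exists>t. b = {t}")
        case True
        then obtain t where t: "b = {t}" by blast
        have "{x\<in>S. b \<in> E x \<union> T x} \<subseteq> N t"
          using irrefl sym t by (auto simp: E_def T_def split: if_splits)
        then show ?thesis using card_mono[OF fin] le order_trans by blast
      next
        case nt: False
        have "b \<notin> E x \<union> T x" for x
        proof
          assume "b \<in> E x \<union> T x"
          then obtain y where "b = {x, y}" "y \<in> N x"
            using nt by (auto simp: E_def T_def split: if_splits)
          moreover from this have "x \<noteq> y" using irrefl by blast
          ultimately show False using False by simp
        qed
        then show ?thesis by simp
      qed
      then show ?thesis using False r by (simp add: w_def)
    qed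
  qed
  then obtain f where inj: "inj_on f S" and f: "\<And>x. x \<in> S \<Longrightarrow> f x \<in> E x \<union> T x" by blast
  have "\<exists>y. y \<in> N x \<and> (y \<in> S \<and> f x = {x, y} \<or> y \<notin> S \<and> f x = {y} \<and> card (N x \<inter> S) < 2)"
    if "x \<in> S" for x
    using f[OF that] by (auto simp: E_def T_def split: if_splits)
  then obtain h where h: "\<And>x. x \<in> S \<Longrightarrow> h x \<in> N x \<and>
      (h x \<in> S \<and> f x = {x, h x} \<or> h x \<notin> S \<and> f x = {h x} \<and> card (N x \<inter> S) < 2)"
    by metis
  show thesis
  proof (rule that)
    show "h x \<in> N x" if "x \<in> S" for x using h that by blast
    show "card (N x \<inter> S) < 2" if "x \<in> S" "h x \<notin> S" for x using h that by blast
    show "x = y" if "x \<in> S" "y \<in> S" "h x \<notin> S" "h x = h y" for x y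
      using h[of x] h[of y] inj that by (metis inj_onD)
    show "inj_on (\<lambda>x. {x, h x}) S"
    proof (rule inj_onI)
      fix x y assume xy: "x \<in> S" "y \<in> S" "{x, h x} = {y, h y}"
      show "x = y"
      proof (rule ccontr)
        \<comment> \<open>Distinct vertices sharing an edge are its two ends, so it lies inside
          \<open>S\<close> and \<open>f\<close> chose the same pair for both.\<close>
        assume "x \<noteq> y"
        then have "h x = y" "h y = x" using xy(3) by (auto simp: doubleton_eq_iff)
        then have "f x = f y" using h[of x] h[of y] xy by auto
        then show False using inj xy \<open>x \<noteq> y\<close> by (auto dest: inj_onD)
      qed
    qed
  qed
qed

section \<open>How many assigned edges meet a given one\<close>

text \<open>If \<open>h x\<close> is outside \<open>S\<close>, no other assigned edge reaches it, so
  only neighbours \<open>y\<close> of \<open>x\<close> in \<open>S\<close> with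
  \<open>h y = x\<close> count. If \<open>h x\<close> is in \<open>S\<close>, the neighbours of
  \<open>x\<close> other than \<open>h x\<close> contribute at most \<open>q - 1\<close>, and the
  end \<open>h x\<close> contributes at most one more.\<close>

lemma card_meeting_partner_edges_le:
  fixes N :: "'a \<Rightarrow> 'a set"
  assumes "finite S"
    and sym: "\<And>u v. v \<in> N u \<Longrightarrow> u \<in> N v"
    and h: "\<And>x. x \<in> S \<Longrightarrow> h x \<in> N x"
    and inj: "inj_on (\<lambda>x. {x, h x}) S"
    and low: "\<And>x. x \<in> S \<Longrightarrow> h x \<notin> S \<Longrightarrow> card (N x \<inter> S) < 2"
    and out: "\<And>x y. x \<in> S \<Longrightarrow> y \<in> S \<Longrightarrow> h x \<notin> S \<Longrightarrow> h x = h y \<Longrightarrow> x = y"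
    and deg: "\<And>v. v \<in> S \<Longrightarrow> card (N v \<inter> S) \<le> q" and q: "q < 3"
    and x: "x \<in> S"
  shows "card {y\<in>S. y \<noteq> x \<and> {y, h y} \<inter> {x, h x} \<noteq> {}} \<le> q" (is "card ?Y \<le> q")
proof (cases "h x \<in> S")
  case False
  have "?Y \<subseteq> N x \<inter> S"
  proof
    fix y assume "y \<in> ?Y"
    then have y: "y \<in> S" "y \<noteq> x" and meet: "{y, h y} \<inter> {x, h x} \<noteq> {}" by blast+
    have "h x \<noteq> h y" using out[OF x y(1) False] y(2) by blast
    then have "h y = x" using meet y False by auto
    then show "y \<in> N x \<inter> S" using h[OF y(1)] sym y(1) by blast
  qed
  then have "card ?Y \<le> card (N x \<inter> S)" using assms(1) by (intro card_mono) auto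
  then show ?thesis using deg[OF x] by simp
next
  case True
  let ?z = "h x"
  \<comment> \<open>The vertex \<open>?z\<close> itself, if different from \<open>x\<close>, is
    counted here; hence it can be removed from the neighbours of \<open>x\<close> below.\<close>
  let ?Z = "{y\<in>S. y \<noteq> x \<and> ?z \<in> {y, h y}}"
  have xz: "x \<in> N ?z \<inter> S" and zx: "?z \<in> N x \<inter> S" using h sym x True by auto
  have swap: "h ?z \<noteq> x" if "?z \<noteq> x"
    using inj_onD[OF inj, of x ?z] x True that by (auto simp: insert_commute)
  have "?Y \<subseteq> (N x \<inter> S - {?z}) \<union> ?Z"
  proof
    fix y assume "y \<in> ?Y"
    then have y: "y \<in> S" "y \<noteq> x" and meet: "{y, h y} \<inter> {x, ?z} \<noteq> {}" by blast+
    show "y \<in> (N x \<inter> S - {?z}) \<union> ?Z"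
    proof (cases "?z \<in> {y, h y}")
      case True
      then show ?thesis using y by blast
    next
      case False
      then have "h y = x" using meet y(2) by auto
      then show ?thesis using h[OF y(1)] sym y(1) False by blast
    qed
  qed
  then have "card ?Y \<le> card ((N x \<inter> S - {?z}) \<union> ?Z)"
    using assms(1) by (intro card_mono) auto
  also have "\<dots> \<le> card (N x \<inter> S - {?z}) + card ?Z" by (rule card_Un_le)
  finally have "card ?Y \<le> card (N x \<inter> S - {?z}) + card ?Z" .
  moreover have "card (N x \<inter> S - {?z}) \<le> q - 1"
    using deg[OF x] zx assms(1) by (simp add: card_Diff_singleton_if diff_le_mono)
  moreover have "card ?Z \<le> 1"
  proof -
    \<comment> \<open>Here \<open>q < 3\<close> matters: \<open>?z\<close> has at most two
      neighbours in \<open>S\<close>, and \<open>x\<close> is one of them.\<close>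
    have rest: "card (N ?z \<inter> S - {x}) \<le> 1"
      using deg[OF True] q xz by (simp add: card_Diff_singleton_if)
    \<comment> \<open>If \<open>h x\<close> has a second neighbour in \<open>S\<close>, both could only contribute the edge joining them.\<close>
    have eq: "h y1 = ?z" if "y1 \<in> ?Z" "y1 \<noteq> ?z" for y1 using that by auto
    have nb: "y \<in> N ?z \<inter> S - {x}" if "y \<in> ?Z" "y \<noteq> ?z" for y
      using that eq[OF that] h[of y] sym[of "h y" y] by auto
    have single: "y1 = y2" if "y1 \<in> N ?z \<inter> S - {x}" "y2 \<in> N ?z \<inter> S - {x}" for y1 y2
      using rest that assms(1) by (metis (no_types, lifting) One_nat_def card_le_Suc0_iff_eq
          finite_Diff finite_Int)
    have clash: False if y: "y \<in> ?Z" "y \<noteq> ?z" and z: "?z \<in> ?Z" for y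
    proof -
      \<comment> \<open>With \<open>x\<close> and \<open>y\<close> both adjacent to
        \<open>?z\<close>, \<open>low\<close> forces \<open>h ?z\<close> into \<open>S\<close>;
        \<open>swap\<close> excludes \<open>x\<close>, so only \<open>y\<close> remains.\<close>
      have two: "\<not> card (N ?z \<inter> S) < 2"
        using nb[OF y] xz assms(1) card_mono[of "N ?z \<inter> S" "{x, y}"] by auto
      then have "h ?z \<in> S" using low[OF True] by blast
      then have "h ?z \<in> N ?z \<inter> S - {x}" using h[OF True] swap z by auto
      then have "h ?z = y" using single nb[OF y] by blast
      then have "{?z, h ?z} = {y, h y}" using eq[OF y] by auto
      then show False using inj_onD[OF inj, of ?z y] True y by blast
    qed
    have "y1 = y2" if "y1 \<in> ?Z" "y2 \<in> ?Z" for y1 y2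
    proof (rule ccontr)
      assume ne: "y1 \<noteq> y2"
      show False
      proof (cases "y1 = ?z \<or> y2 = ?z")
        case True
        then show False using clash[of y1] clash[of y2] that ne by blast
      next
        case False
        then show False using single nb that ne by blast
      qed
    qed
    moreover have "finite ?Z" using assms(1) by simp
    ultimately show ?thesis unfolding One_nat_def by (subst card_le_Suc0_iff_eq) blast+
  qed
  \<comment> \<open>Subtraction on naturals truncates, so \<open>(q - 1) + 1 = q\<close> requires
    this.\<close>
  moreover have "1 \<le> q"
  proof -
    have "0 < card (N x \<inter> S)" using zx assms(1) card_gt_0_iff by blast
    then show ?thesis using deg[OF x] by linarith
  qed
  ultimately show ?thesis by linarith
qed

section \<open>Degrees as numbers of neighbours\<close>

text \<open>Without parallel arcs, \<open>head\<close> is injective on the arcs leaving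
  \<open>v\<close>.\<close>

lemma (in nomulti_digraph) out_degree_eq_card_dominated:
  "out_degree G v = card {u. v \<rightarrow>\<^bsub>G\<^esub> u}"
proof -
  have "inj_on (head G) (out_arcs G v)"
    by (rule inj_onI) (auto intro!: no_multi_arcs simp: arc_to_ends_def)
  then have "out_degree G v = card (head G ` out_arcs G v)"
    by (simp add: out_degree_def card_image)
  also have "head G ` out_arcs G v = {u. v \<rightarrow>\<^bsub>G\<^esub> u}"
    by (auto simp: arcs_ends_def arc_to_ends_def image_iff)
  finally show ?thesis .
qed

lemma out_degree_induce_subgraph:
  assumes "graph G" and "S \<subseteq> verts G" and "v \<in> S"
  shows "out_degree (induce_subgraph G S) v = card ({u. v \<rightarrow>\<^bsub>G\<^esub> u} \<inter> S)"
proof -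
  interpret graph G by fact
  interpret H: digraph "induce_subgraph G S"
    using assms(2) by (intro digraphI_induced induced_induce)
  have "{u. v \<rightarrow>\<^bsub>induce_subgraph G S\<^esub> u} = {u. v \<rightarrow>\<^bsub>G\<^esub> u} \<inter> S"
    using assms(3) by (auto simp: arcs_ends_def arc_to_ends_def image_iff)
  then show ?thesis by (simp add: H.out_degree_eq_card_dominated)
qed

lemma dominates_line_graph:
  "e \<rightarrow>\<^bsub>line_graph G\<^esub> f \<longleftrightarrow>
    e \<in> undirected_edges G \<and> f \<in> undirected_edges G \<and> e \<noteq> f \<and> e \<inter> f \<noteq> {}"
  by (simp add: line_graph_def)

section \<open>Comparison of the two independence numbers\<close>

theorem theorem10:
  fixes G :: "('a, 'b) pre_digraph" and r p q :: nat
  assumes "graph G" and "regular r G" and "r \<ge> 2"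
    and "p \<le> q" and "q < 3"
  shows "p_independence_number p G \<le> p_independence_number q (line_graph G)"
proof -
  interpret graph G by fact
  define N where "N v = {u. v \<rightarrow>\<^bsub>G\<^esub> u}" for v
  have sym: "u \<in> N v" if "v \<in> N u" for u v
    using that arcs_ends_symmetric[OF sym_arcs] by (simp add: N_def)
  have irrefl: "v \<notin> N v" for v using adj_not_same by (auto simp: N_def)
  have NV: "N v \<subseteq> verts G" for v by (auto simp: N_def)
  have fin: "finite (N v)" for v using NV finite_verts by (rule finite_subset)
  have reg: "card (N v) = r" if "v \<in> verts G" for v
    using that assms(2) by (simp add: regular_def N_def out_degree_eq_card_dominated)
  have le: "card (N v) \<le> r" for v
  proof (cases "v \<in> verts G")
    case True
    then show ?thesis using reg by simp
  next
    case False
    then have "N v = {}" by (auto simp: N_def)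
    then show ?thesis by simp
  qed
  let ?L = "line_graph G"
  have gL: "graph ?L" using assms(1) by (rule graph_line_graph)
  have "card S \<le> p_independence_number q ?L" if S: "p_independent p G S" for S
  proof -
    have SV: "S \<subseteq> verts G" using S by (simp add: p_independent_def)
    have finS: "finite S" using SV finite_verts by (rule finite_subset)
    \<comment> \<open>By \<open>p \<le> q\<close> the degrees in \<open>S\<close> are at most
      \<open>q\<close>; from here on only \<open>q\<close> is used for \<open>S\<close>.\<close>
    have deg: "card (N v \<inter> S) \<le> q" if "v \<in> S" for v
      using S that assms(4) out_degree_induce_subgraph[OF assms(1) SV that]
      by (auto simp: p_independent_def N_def)
    obtain h where h: "\<And>x. x \<in> S \<Longrightarrow> h x \<in> N x" and inj: "inj_on (\<lambda>x. {x, h x}) S"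
      and low: "\<And>x. x \<in> S \<Longrightarrow> h x \<notin> S \<Longrightarrow> card (N x \<inter> S) < 2"
      and out: "\<And>x y. x \<in> S \<Longrightarrow> y \<in> S \<Longrightarrow> h x \<notin> S \<Longrightarrow> h x = h y \<Longrightarrow> x = y"
    proof (rule exists_partner_assignment[OF finS, of N r])
      show "card (N v) = r" if "v \<in> S" for v using reg SV that by blast
      show "card (N v \<inter> S) \<le> 2" if "v \<in> S" for v using deg[OF that] assms(5) by simp
    qed (use sym irrefl fin le assms(3) in auto)
    let ?g = "\<lambda>x. {x, h x}"
    let ?F = "?g ` S"
    have FV: "?F \<subseteq> verts ?L"
      using h by (auto simp: line_graph_def undirected_edges_def N_def)
    have "p_independent q ?L ?F"
      unfolding p_independent_def
    proof (intro conjI ballI FV)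
      fix e assume e: "e \<in> ?F"
      then obtain x where x: "x \<in> S" "e = ?g x" by blast
      \<comment> \<open>Distinct edges come from distinct vertices, so it suffices to count the
        vertices whose edges meet \<open>e\<close>.\<close>
      have "{f. e \<rightarrow>\<^bsub>?L\<^esub> f} \<inter> ?F \<subseteq> ?g ` {y\<in>S. y \<noteq> x \<and> ?g y \<inter> ?g x \<noteq> {}}"
      proof
        fix f assume f: "f \<in> {f. e \<rightarrow>\<^bsub>?L\<^esub> f} \<inter> ?F"
        then obtain y where y: "y \<in> S" "f = ?g y" by blast
        have "e \<noteq> f" and "f \<inter> e \<noteq> {}" using f by (auto simp: dominates_line_graph)
        then have "y \<in> {y\<in>S. y \<noteq> x \<and> ?g y \<inter> ?g x \<noteq> {}}" using x y by blast
        with y(2) show "f \<in> ?g ` {y\<in>S. y \<noteq> x \<and> ?g y \<inter> ?g x \<noteq> {}}" by (rule image_eqI)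
      qed
      then have "card ({f. e \<rightarrow>\<^bsub>?L\<^esub> f} \<inter> ?F) \<le> card {y\<in>S. y \<noteq> x \<and> ?g y \<inter> ?g x \<noteq> {}}"
        by (rule surj_card_le[rotated]) (simp add: finS)
      also have "\<dots> \<le> q"
        by (rule card_meeting_partner_edges_le[OF finS sym h inj low out deg assms(5) x(1)])
      finally show "out_degree (induce_subgraph ?L ?F) e \<le> q"
        using out_degree_induce_subgraph[OF gL FV e] by simp
    qed
    then have "card ?F \<le> p_independence_number q ?L"
      unfolding p_independence_number_def using finite_p_independent[OF gL] by (intro Max_ge) auto
    then show ?thesis using inj by (simp add: card_image)
  qed
  \<comment> \<open>The empty set makes the family under \<open>Max\<close> nonempty, so a bound on
    all its members bounds the maximum.\<close>
  then show ?thesis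
    using finite_p_independent[OF assms(1), of p] p_independent_empty[of p G]
    unfolding p_independence_number_def[of p G] by (subst Max_le_iff) auto
qed

end
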